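(* Let $\mathbb{T}$ be a time scale, $a,b\in\mathbb{T}$ with $a<b$, $t\in(a,b]_{\mathbb{T}}$, and $0\le\alpha\le 1$. Let $w,f,g\in C([a,b]_{\mathbb{T}},\mathbb{R})$ be diamond-$\alpha$ integrable functions and let $K:[a,b]_{\mathbb{T}}\times[a,b]_{\mathbb{T}}\to[0,\infty)$ be a nonnegative kernel. Assume that all the integrals appearing below exist and are finite. Suppose further that there exist constants $m,M>0$ such that \[ 0<m\leq\frac{|f(s)|}{|g(s)|}\leq M<\infty,\qquad s\in[a,t]_{\mathbb{T}} \] (in particular $g(s)\neq0$ for these $s$). Then, for every $\delta\in[0,1]$, with $\gamma=\max\{1-\delta,\delta\}$, \[ \begin{aligned} &\mathcal{I}_{K}^{\alpha}(|w||f|^2)(t)\,\mathcal{I}_{K}^{\alpha}(|w||g|^2)(t)\\ &\quad-\mathcal{I}_{K}^{\alpha}\big(|w||f|^{2(1-\delta)}|g|^{2\delta}\big)(t)\,\mathcal{I}_{K}^{\alpha}\big(|w||f|^{2\delta}|g|^{2(1-\delta)}\big)(t)\\ &\leq\gamma(M-m)^2\Big[\mathcal{I}_{K}^{\alpha}(|w||g|^2)(t)\Big]^2. \end{aligned} \]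
   Context: A time scale $\mathbb{T}$ is a nonempty closed subset of $\mathbb{R}$. For $a,b\in\mathbb{T}$, $[a,b]_{\mathbb{T}}=[a,b]\cap\mathbb{T}$ and $(a,b]_{\mathbb{T}}=(a,b]\cap\mathbb{T}$. For $0\le\alpha\le1$ and $h$ delta and nabla integrable on $[a,b]_{\mathbb{T}}$, the diamond-$\alpha$ integral is \[ \int_a^b h(s)\diamond_\alpha s=\alpha\int_a^b h(s)\,\Delta s+(1-\alpha)\int_a^b h(s)\,\nabla s, \] where $\int\cdot\,\Delta s$ and $\int\cdot\,\nabla s$ are the usual delta and nabla integrals of time scale calculus. For a nonnegative kernel $K:[a,b]_{\mathbb{T}}\times[a,b]_{\mathbb{T}}\to[0,\infty)$ and a suitable function $h:[a,b]_{\mathbb{T}}\to\mathbb{R}$, the kernel-type diamond-$\alpha$ integral operator is \[ \mathcal{I}_{K}^{\alpha}h(t)=\int_a^t K(t,s)h(s)\diamond_\alpha s, \] provided that the integral exists and is finite. An expression such as $|w||f|^2$ denotes the function $s\mapsto|w(s)||f(s)|^2$. *)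

theory Defs
  imports "HOL-Analysis.Analysis"
begin

definition time_scale :: "real set \<Rightarrow> bool" where
  "time_scale T \<longleftrightarrow> closed T \<and> T \<noteq> {}"

text \<open>
  The delta and nabla integrals are the Lebesgue ones: the delta (nabla) measure is the
  Caratheodory extension of the length, \<open>[c,d)\<^sub>T \<mapsto> d - c\<close> (respectively
  \<open>(c,d]\<^sub>T \<mapsto> d - c\<close>) for \<open>c \<le> d\<close> in \<open>T\<close>. They extend the Riemann integrals and the
  Cauchy integrals of rd-continuous (ld-continuous) functions.
  The argument \<open>J\<close> below is the shape of the intervals.
  The outer measure is \<open>\<infinity>\<close> on sets that have no countable cover by such intervals, e.g. on
  sets containing the maximum of \<open>T\<close> in the delta case.
\<close>

definition ts_outer_measure ::
  "(real \<Rightarrow> real \<Rightarrow> real set) \<Rightarrow> real set \<Rightarrow> real set \<Rightarrow> ennreal" where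
  "ts_outer_measure J T E =
     (INF (c, d) \<in> {(c, d). (\<forall>n::nat. c n \<in> T \<and> d n \<in> T \<and> c n \<le> d n) \<and> E \<subseteq> (\<Union>n. J (c n) (d n))}.
        \<Sum>n. ennreal (d n - c n))"

definition ts_measure :: "(real \<Rightarrow> real \<Rightarrow> real set) \<Rightarrow> real set \<Rightarrow> real measure" where
  "ts_measure J T =
     measure_of T (lambda_system T (Pow T) (ts_outer_measure J T)) (ts_outer_measure J T)"

definition delta_measure :: "real set \<Rightarrow> real measure" where
  "delta_measure = ts_measure (\<lambda>c d. {c..<d})"

definition nabla_measure :: "real set \<Rightarrow> real measure" where
  "nabla_measure = ts_measure (\<lambda>c d. {c<..d})"

text \<open>
  All integrals are over intervals with \<open>a \<le> t\<close>, so no orientation is needed.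
\<close>

definition delta_integrable :: "real set \<Rightarrow> real \<Rightarrow> real \<Rightarrow> (real \<Rightarrow> real) \<Rightarrow> bool" where
  "delta_integrable T a t h \<longleftrightarrow> set_integrable (delta_measure T) ({a..<t} \<inter> T) h"

definition nabla_integrable :: "real set \<Rightarrow> real \<Rightarrow> real \<Rightarrow> (real \<Rightarrow> real) \<Rightarrow> bool" where
  "nabla_integrable T a t h \<longleftrightarrow> set_integrable (nabla_measure T) ({a<..t} \<inter> T) h"

definition delta_integral :: "real set \<Rightarrow> real \<Rightarrow> real \<Rightarrow> (real \<Rightarrow> real) \<Rightarrow> real" where
  "delta_integral T a t h = set_lebesgue_integral (delta_measure T) ({a..<t} \<inter> T) h"

definition nabla_integral :: "real set \<Rightarrow> real \<Rightarrow> real \<Rightarrow> (real \<Rightarrow> real) \<Rightarrow> real" where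
  "nabla_integral T a t h = set_lebesgue_integral (nabla_measure T) ({a<..t} \<inter> T) h"

definition diamond_integrable :: "real set \<Rightarrow> real \<Rightarrow> real \<Rightarrow> (real \<Rightarrow> real) \<Rightarrow> bool" where
  "diamond_integrable T a t h \<longleftrightarrow> delta_integrable T a t h \<and> nabla_integrable T a t h"

definition diamond_integral :: "real \<Rightarrow> real set \<Rightarrow> real \<Rightarrow> real \<Rightarrow> (real \<Rightarrow> real) \<Rightarrow> real" where
  "diamond_integral \<alpha> T a t h = \<alpha> * delta_integral T a t h + (1 - \<alpha>) * nabla_integral T a t h"

definition kernel_operator_exists ::
  "real set \<Rightarrow> real \<Rightarrow> (real \<Rightarrow> real \<Rightarrow> real) \<Rightarrow> (real \<Rightarrow> real) \<Rightarrow> real \<Rightarrow> bool" where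
  "kernel_operator_exists T a K h t \<longleftrightarrow> diamond_integrable T a t (\<lambda>s. K t s * h s)"

definition kernel_operator ::
  "real \<Rightarrow> real set \<Rightarrow> real \<Rightarrow> (real \<Rightarrow> real \<Rightarrow> real) \<Rightarrow> (real \<Rightarrow> real) \<Rightarrow> real \<Rightarrow> real" where
  "kernel_operator \<alpha> T a K h t = diamond_integral \<alpha> T a t (\<lambda>s. K t s * h s)"


text \<open>
  The construction does yield measures, with the prescribed values on intervals.
\<close>

definition half_open :: "(real \<Rightarrow> real \<Rightarrow> real set) \<Rightarrow> bool" where
  "half_open J \<longleftrightarrow> J = (\<lambda>c d. {c..<d}) \<or> J = (\<lambda>c d. {c<..d})"

lemma ts_outer_measure_le:
  assumes "\<And>n::nat. c n \<in> T \<and> d n \<in> T \<and> c n \<le> d n" "E \<subseteq> (\<Union>n. J (c n) (d n))"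
  shows "ts_outer_measure J T E \<le> (\<Sum>n. ennreal (d n - c n))"
  unfolding ts_outer_measure_def using assms by (intro INF_lower2[of "(c, d)"]) auto

lemma ts_outer_measure_approx:
  assumes "ts_outer_measure J T E < y"
  obtains c d where "\<And>n::nat. c n \<in> T \<and> d n \<in> T \<and> c n \<le> d n" "E \<subseteq> (\<Union>n. J (c n) (d n))"
    "(\<Sum>n. ennreal (d n - c n)) < y"
  using assms unfolding ts_outer_measure_def by (auto simp: INF_less_iff)

lemma ts_outer_measure_mono: "E \<subseteq> F \<Longrightarrow> ts_outer_measure J T E \<le> ts_outer_measure J T F"
  unfolding ts_outer_measure_def by (intro INF_superset_mono) auto

lemma ts_outer_measure_interval_le:
  assumes "half_open J" "c \<in> T" "d \<in> T" "E \<subseteq> J c d"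
  shows "ts_outer_measure J T E \<le> ennreal (d - c)"
proof -
  have *: "ts_outer_measure J T E \<le> (\<Sum>n::nat. ennreal ((if n = 0 then max c d else c) - c))"
    using assms by (intro ts_outer_measure_le) (auto simp: half_open_def max_def split: if_splits)
  have "(\<Sum>n::nat. ennreal ((if n = 0 then max c d else c) - c)) = ennreal (max c d - c)"
    by (subst suminf_finite[of "{0}"]) auto
  then show ?thesis using * by (auto simp: max_def ennreal_neg split: if_splits)
qed

lemma ts_outer_measure_empty:
  assumes "half_open J" "T \<noteq> {}"
  shows "ts_outer_measure J T {} = 0"
  using ts_outer_measure_interval_le[OF assms(1), of _ T _ "{}"] assms(2)
  by (metis all_not_in_conv diff_self empty_subsetI ennreal_0 le_zero_eq)

lemma ts_outer_measure_UN_le: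
  fixes A :: "nat \<Rightarrow> real set"
  shows "ts_outer_measure J T (\<Union>i. A i) \<le> (\<Sum>i. ts_outer_measure J T (A i))"
proof (cases "(\<Sum>i. ts_outer_measure J T (A i)) = top")
  case False
  show ?thesis
  proof (rule ennreal_le_epsilon)
    fix e :: real
    assume e: "0 < e"
    define \<epsilon> where "\<epsilon> i = e * (1/2) ^ Suc i" for i :: nat
    have \<epsilon>: "\<epsilon> i > 0" for i using e by (simp add: \<epsilon>_def)
    have fin: "ts_outer_measure J T (A i) \<noteq> top" for i
      using False ennreal_suminf_lessD[of "\<lambda>i. ts_outer_measure J T (A i)" top]
      by (simp add: top.not_eq_extremum)
    have less: "ts_outer_measure J T (A i) < ts_outer_measure J T (A i) + ennreal (\<epsilon> i)" for i
      using fin[of i] \<epsilon>[of i]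
      by (cases "ts_outer_measure J T (A i)")
        (auto simp: ennreal_plus[symmetric] ennreal_less_iff simp del: ennreal_plus)
    have "\<exists>p. (\<forall>n::nat. fst p n \<in> T \<and> snd p n \<in> T \<and> fst p n \<le> snd p n) \<and>
        A i \<subseteq> (\<Union>n. J (fst p n) (snd p n)) \<and>
        (\<Sum>n. ennreal (snd p n - fst p n)) < ts_outer_measure J T (A i) + ennreal (\<epsilon> i)" for i
    proof -
      obtain c d where "\<And>n::nat. c n \<in> T \<and> d n \<in> T \<and> c n \<le> d n" "A i \<subseteq> (\<Union>n. J (c n) (d n))"
        "(\<Sum>n. ennreal (d n - c n)) < ts_outer_measure J T (A i) + ennreal (\<epsilon> i)"
        by (rule ts_outer_measure_approx[OF less[of i]]) blast
      then show ?thesis by (intro exI[of _ "(c, d)"]) simp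
    qed
    then have "\<exists>p. \<forall>i. (\<forall>n::nat. fst (p i) n \<in> T \<and> snd (p i) n \<in> T \<and> fst (p i) n \<le> snd (p i) n) \<and>
        A i \<subseteq> (\<Union>n. J (fst (p i) n) (snd (p i) n)) \<and>
        (\<Sum>n. ennreal (snd (p i) n - fst (p i) n)) < ts_outer_measure J T (A i) + ennreal (\<epsilon> i)"
      by (rule choice[OF allI])
    then obtain p where p: "\<forall>i. (\<forall>n::nat. fst (p i) n \<in> T \<and> snd (p i) n \<in> T \<and> fst (p i) n \<le> snd (p i) n) \<and>
        A i \<subseteq> (\<Union>n. J (fst (p i) n) (snd (p i) n)) \<and>
        (\<Sum>n. ennreal (snd (p i) n - fst (p i) n)) < ts_outer_measure J T (A i) + ennreal (\<epsilon> i)"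
      by (elim exE)
    define c d where "c i = fst (p i)" and "d i = snd (p i)" for i
    have cd: "\<And>i n::nat. c i n \<in> T \<and> d i n \<in> T \<and> c i n \<le> d i n"
      "\<And>i. A i \<subseteq> (\<Union>n. J (c i n) (d i n))"
      "\<And>i. (\<Sum>n. ennreal (d i n - c i n)) < ts_outer_measure J T (A i) + ennreal (\<epsilon> i)"
      using p unfolding c_def d_def by blast+
    define c' where "c' k = (case prod_decode k of (i, n) \<Rightarrow> c i n)" for k
    define d' where "d' k = (case prod_decode k of (i, n) \<Rightarrow> d i n)" for k
    have "(\<Union>i. A i) \<subseteq> (\<Union>k. J (c' k) (d' k))"
    proof safe
      fix x i assume "x \<in> A i"
      then obtain n where "x \<in> J (c i n) (d i n)" using cd(2)[of i] by auto
      then show "x \<in> (\<Union>k. J (c' k) (d' k))"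
        by (intro UN_I[of "prod_encode (i, n)"]) (auto simp: c'_def d'_def)
    qed
    then have "ts_outer_measure J T (\<Union>i. A i) \<le> (\<Sum>k. ennreal (d' k - c' k))"
      using cd(1) by (intro ts_outer_measure_le) (auto simp: c'_def d'_def split: prod.split)
    also have "\<dots> = (\<Sum>k. (\<lambda>(i, n). ennreal (d i n - c i n)) (prod_decode k))"
      by (simp add: c'_def d'_def split_beta)
    also have "\<dots> = (\<Sum>i. \<Sum>n. ennreal (d i n - c i n))"
      using suminf_ennreal_2dimen[of "\<lambda>i. \<Sum>n. ennreal (d i n - c i n)" "\<lambda>(i, n). ennreal (d i n - c i n)"]
      by (simp add: comp_def)
    also have "\<dots> \<le> (\<Sum>i. ts_outer_measure J T (A i) + ennreal (\<epsilon> i))"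
      using cd(3) by (intro suminf_le) (auto intro: less_imp_le)
    also have "\<dots> = (\<Sum>i. ts_outer_measure J T (A i)) + (\<Sum>i. ennreal (\<epsilon> i))"
      by (simp add: suminf_add)
    also have "(\<Sum>i. ennreal (\<epsilon> i)) = ennreal e"
    proof (rule suminf_ennreal_eq)
      show "0 \<le> \<epsilon> i" for i using \<epsilon>[of i] by simp
      show "\<epsilon> sums e"
        using sums_mult[OF power_half_series, of e] by (simp add: \<epsilon>_def[abs_def])
    qed
    finally show "ts_outer_measure J T (\<Union>i. A i) \<le> (\<Sum>i. ts_outer_measure J T (A i)) + ennreal e" .
  qed
qed simp

lemma ts_outer_measure_space:
  assumes "half_open J" "T \<noteq> {}"
  shows "outer_measure_space (Pow T) (ts_outer_measure J T)"
  unfolding outer_measure_space_def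
proof (intro conjI)
  show "positive (Pow T) (ts_outer_measure J T)"
    using ts_outer_measure_empty[OF assms] by (simp add: positive_def)
  show "increasing (Pow T) (ts_outer_measure J T)"
    by (auto simp: increasing_def intro: ts_outer_measure_mono)
  show "countably_subadditive (Pow T) (ts_outer_measure J T)"
    by (auto simp: countably_subadditive_def intro: ts_outer_measure_UN_le)
qed

lemma ts_outer_measure_Un_le:
  assumes "half_open J" "T \<noteq> {}"
  shows "ts_outer_measure J T (A \<union> B) \<le> ts_outer_measure J T A + ts_outer_measure J T B"
proof -
  have "ts_outer_measure J T (\<Union>i. binaryset A B i) \<le> (\<Sum>i. ts_outer_measure J T (binaryset A B i))"
    by (rule ts_outer_measure_UN_le)
  also have "\<dots> = ts_outer_measure J T A + ts_outer_measure J T B"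
    by (intro suminf_binaryset_eq ts_outer_measure_empty assms)
  finally show ?thesis by (simp add: UN_binaryset_eq)
qed

lemma measure_space_ts:
  assumes "half_open J" "T \<noteq> {}"
  shows "measure_space T (lambda_system T (Pow T) (ts_outer_measure J T)) (ts_outer_measure J T)"
  by (intro sigma_algebra.caratheodory_lemma sigma_algebra_Pow ts_outer_measure_space assms)

lemma
  assumes "half_open J" "T \<noteq> {}"
  shows space_ts_measure: "space (ts_measure J T) = T"
    and sets_ts_measure: "sets (ts_measure J T) = lambda_system T (Pow T) (ts_outer_measure J T)"
    and emeasure_ts_measure:
      "X \<in> sets (ts_measure J T) \<Longrightarrow> emeasure (ts_measure J T) X = ts_outer_measure J T X"
proof -
  let ?L = "lambda_system T (Pow T) (ts_outer_measure J T)"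
  have sa: "sigma_algebra T ?L" and ms: "positive ?L (ts_outer_measure J T)"
      "countably_additive ?L (ts_outer_measure J T)"
    using measure_space_ts[OF assms] by (auto simp: measure_space_def)
  have L: "?L \<subseteq> Pow T" by (auto simp: lambda_system_def)
  show "space (ts_measure J T) = T" using L by (simp add: ts_measure_def space_measure_of)
  show sets: "sets (ts_measure J T) = ?L"
    using L sa by (simp add: ts_measure_def sets_measure_of sigma_algebra.sigma_sets_eq)
  show "emeasure (ts_measure J T) X = ts_outer_measure J T X" if "X \<in> sets (ts_measure J T)"
    unfolding ts_measure_def
    using that sets ms sa by (intro emeasure_measure_of_sigma) auto
qed

lemma suminf_cut_le:
  fixes c d :: "nat \<Rightarrow> real"
  assumes cd: "\<And>n. c n \<le> d n" and "a \<le> b"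
  shows "(\<Sum>n. ennreal (max (c n) (min (d n) a) - c n)) +
      ((\<Sum>n. ennreal (max (max (c n) a) (min (d n) b) - max (c n) a)) +
       (\<Sum>n. ennreal (max (max (c n) b) (d n) - max (c n) b))) \<le> (\<Sum>n. ennreal (d n - c n))"
proof -
  have "ennreal (max (c n) (min (d n) a) - c n) +
      (ennreal (max (max (c n) a) (min (d n) b) - max (c n) a) +
       ennreal (max (max (c n) b) (d n) - max (c n) b)) = ennreal (d n - c n)" for n
    using cd[of n] \<open>a \<le> b\<close> by (auto simp: ennreal_plus[symmetric] max_def min_def simp del: ennreal_plus)
  then show ?thesis by (simp add: suminf_add)
qed

lemma interval_in_sets_ts_measure:
  assumes J: "half_open J" and ab: "a \<in> T" "b \<in> T" "a \<le> b"
  shows "J a b \<inter> T \<in> sets (ts_measure J T)"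
proof -
  let ?f = "ts_outer_measure J T"
  have ne: "T \<noteq> {}" using ab by auto
  have *: "?f (X \<inter> (J a b \<inter> T)) + ?f (X - J a b \<inter> T) = ?f X" if X: "X \<subseteq> T" for X
  proof (rule antisym)
    have "?f X = ?f ((X \<inter> (J a b \<inter> T)) \<union> (X - J a b \<inter> T))" by (simp add: Int_Diff_Un)
    also have "\<dots> \<le> ?f (X \<inter> (J a b \<inter> T)) + ?f (X - J a b \<inter> T)"
      by (rule ts_outer_measure_Un_le[OF J ne])
    finally show "?f X \<le> ?f (X \<inter> (J a b \<inter> T)) + ?f (X - J a b \<inter> T)" .
    show "?f (X \<inter> (J a b \<inter> T)) + ?f (X - J a b \<inter> T) \<le> ?f X"
    proof (rule dense_ge)
      fix y assume "?f X < y"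
      then obtain c d where cd: "\<And>n::nat. c n \<in> T \<and> d n \<in> T \<and> c n \<le> d n"
          "X \<subseteq> (\<Union>n. J (c n) (d n))" "(\<Sum>n. ennreal (d n - c n)) < y"
        by (rule ts_outer_measure_approx) blast
      define L R where "L = (\<Union>n. J (c n) (max (c n) (min (d n) a)))"
        and "R = (\<Union>n. J (max (c n) b) (max (max (c n) b) (d n)))"
      have sub: "X - J a b \<inter> T \<subseteq> L \<union> R"
      proof
        fix x assume x: "x \<in> X - J a b \<inter> T"
        then obtain n where "x \<in> J (c n) (d n)" using cd(2) by auto
        then have "x \<in> J (c n) (max (c n) (min (d n) a)) \<or> x \<in> J (max (c n) b) (max (max (c n) b) (d n))"
          using J x X by (auto simp: half_open_def max_def min_def)
        then show "x \<in> L \<union> R" by (auto simp: L_def R_def)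
      qed
      have mid: "X \<inter> (J a b \<inter> T) \<subseteq> (\<Union>n. J (max (c n) a) (max (max (c n) a) (min (d n) b)))"
      proof
        fix x assume x: "x \<in> X \<inter> (J a b \<inter> T)"
        then obtain n where "x \<in> J (c n) (d n)" using cd(2) by auto
        then have "x \<in> J (max (c n) a) (max (max (c n) a) (min (d n) b))"
          using J x X by (auto simp: half_open_def max_def min_def)
        then show "x \<in> (\<Union>n. J (max (c n) a) (max (max (c n) a) (min (d n) b)))" by auto
      qed
      have "?f (X \<inter> (J a b \<inter> T)) \<le> (\<Sum>n. ennreal (max (max (c n) a) (min (d n) b) - max (c n) a))"
        using cd(1) ab by (intro ts_outer_measure_le mid) (auto simp: max_def min_def)
      moreover have "?f (X - J a b \<inter> T) \<le> ?f L + ?f R"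
        using ts_outer_measure_mono[OF sub] ts_outer_measure_Un_le[OF J ne] by (rule order_trans)
      moreover have "?f L \<le> (\<Sum>n. ennreal (max (c n) (min (d n) a) - c n))"
        unfolding L_def using cd(1) ab by (intro ts_outer_measure_le) (auto simp: max_def min_def)
      moreover have "?f R \<le> (\<Sum>n. ennreal (max (max (c n) b) (d n) - max (c n) b))"
        unfolding R_def using cd(1) ab by (intro ts_outer_measure_le) (auto simp: max_def min_def)
      ultimately have "?f (X \<inter> (J a b \<inter> T)) + ?f (X - J a b \<inter> T) \<le>
          (\<Sum>n. ennreal (max (c n) (min (d n) a) - c n)) +
          ((\<Sum>n. ennreal (max (max (c n) a) (min (d n) b) - max (c n) a)) +
           (\<Sum>n. ennreal (max (max (c n) b) (d n) - max (c n) b)))"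
        by (subst add.left_commute) (intro add_mono; meson add_mono order_trans)
      also have "\<dots> \<le> (\<Sum>n. ennreal (d n - c n))"
        using cd(1) ab(3) by (intro suminf_cut_le) auto
      finally show "?f (X \<inter> (J a b \<inter> T)) + ?f (X - J a b \<inter> T) \<le> y"
        using cd(3) by simp
    qed
  qed
  show ?thesis
    unfolding sets_ts_measure[OF J ne] algebra.lambda_system_eq[OF algebra_Pow]
    using * by auto
qed

lemma lborel_half_open:
  assumes "half_open J" "c \<le> d"
  shows "J c d \<in> sets lborel" "emeasure lborel (J c d) = ennreal (d - c)"
  using assms by (auto simp: half_open_def)

text \<open>
  If intervals with endpoints in \<open>T\<close> cover \<open>[a,b)\<^sub>T\<close>, they also cover \<open>[a,b)\<close>, because an
  interval reaching into a gap of \<open>T\<close> contains the whole gap.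
\<close>

lemma cover_gaps:
  assumes "closed T" and J: "half_open J" and ab: "a \<in> T" "b \<in> T"
    and cd: "\<And>n::nat. c n \<in> T \<and> d n \<in> T" and cover: "J a b \<inter> T \<subseteq> (\<Union>n. J (c n) (d n))"
  shows "J a b \<subseteq> (\<Union>n. J (c n) (d n))"
  using J unfolding half_open_def
proof
  assume Jd: "J = (\<lambda>c d. {c..<d})"
  show ?thesis
  proof
    fix x assume x: "x \<in> J a b"
    define s where "s = Sup (T \<inter> {a..x})"
    have ne: "T \<inter> {a..x} \<noteq> {}" "bdd_above (T \<inter> {a..x})" using x ab Jd by auto
    have sT: "s \<in> T \<inter> {a..x}"
      unfolding s_def by (rule closed_contains_Sup[OF ne]) (use \<open>closed T\<close> in auto)
    have le: "u \<le> s" if "u \<in> T" "a \<le> u" "u \<le> x" for u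
      unfolding s_def using that ne by (intro cSup_upper) auto
    have s: "s \<in> T" "a \<le> s" "s \<le> x" using sT by auto
    then have "s \<in> J a b \<inter> T" using x Jd by auto
    then obtain n where n: "s \<in> J (c n) (d n)" using cover by blast
    have "x < d n"
    proof (rule ccontr)
      assume "\<not> x < d n"
      then have "d n \<le> s" using n s cd[of n] Jd by (intro le) auto
      then show False using n Jd by auto
    qed
    then have "x \<in> J (c n) (d n)" using n s Jd by auto
    then show "x \<in> (\<Union>n. J (c n) (d n))" by blast
  qed
next
  assume Jd: "J = (\<lambda>c d. {c<..d})"
  show ?thesis
  proof
    fix x assume x: "x \<in> J a b"
    define s where "s = Inf (T \<inter> {x..b})"
    have ne: "T \<inter> {x..b} \<noteq> {}" "bdd_below (T \<inter> {x..b})" using x ab Jd by auto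
    have sT: "s \<in> T \<inter> {x..b}"
      unfolding s_def by (rule closed_contains_Inf[OF ne]) (use \<open>closed T\<close> in auto)
    have le: "s \<le> u" if "u \<in> T" "x \<le> u" "u \<le> b" for u
      unfolding s_def using that ne by (intro cInf_lower) auto
    have s: "s \<in> T" "x \<le> s" "s \<le> b" using sT by auto
    then have "s \<in> J a b \<inter> T" using x Jd by auto
    then obtain n where n: "s \<in> J (c n) (d n)" using cover by blast
    have "c n < x"
    proof (rule ccontr)
      assume "\<not> c n < x"
      then have "s \<le> c n" using n s cd[of n] Jd by (intro le) auto
      then show False using n Jd by auto
    qed
    then have "x \<in> J (c n) (d n)" using n s Jd by auto
    then show "x \<in> (\<Union>n. J (c n) (d n))" by blast
  qed
qed

lemma emeasure_ts_measure_interval: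
  assumes "closed T" and J: "half_open J" and ab: "a \<in> T" "b \<in> T" "a \<le> b"
  shows "emeasure (ts_measure J T) (J a b \<inter> T) = ennreal (b - a)"
proof -
  have ne: "T \<noteq> {}" using ab by auto
  have "ts_outer_measure J T (J a b \<inter> T) = ennreal (b - a)"
  proof (rule antisym)
    show "ts_outer_measure J T (J a b \<inter> T) \<le> ennreal (b - a)"
      using J ab by (intro ts_outer_measure_interval_le) auto
    show "ennreal (b - a) \<le> ts_outer_measure J T (J a b \<inter> T)"
    proof (rule dense_ge)
      fix y assume "ts_outer_measure J T (J a b \<inter> T) < y"
      then obtain c d where cd: "\<And>n::nat. c n \<in> T \<and> d n \<in> T \<and> c n \<le> d n"
          "J a b \<inter> T \<subseteq> (\<Union>n. J (c n) (d n))" "(\<Sum>n. ennreal (d n - c n)) < y"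
        by (rule ts_outer_measure_approx) blast
      have "J a b \<subseteq> (\<Union>n. J (c n) (d n))"
        by (rule cover_gaps[OF assms(1) J ab(1,2)]) (use cd in auto)
      then have "emeasure lborel (J a b) \<le> emeasure lborel (\<Union>n. J (c n) (d n))"
        using lborel_half_open(1)[OF J] cd(1) by (intro emeasure_mono sets.countable_UN) auto
      also have "\<dots> \<le> (\<Sum>n. emeasure lborel (J (c n) (d n)))"
        using lborel_half_open(1)[OF J] cd(1) by (intro emeasure_subadditive_countably) auto
      also have "\<dots> = (\<Sum>n. ennreal (d n - c n))"
        using lborel_half_open(2)[OF J] cd(1) by simp
      finally show "ennreal (b - a) \<le> y"
        using cd(3) lborel_half_open(2)[OF J ab(3)] by simp
    qed
  qed
  then show ?thesis
    using emeasure_ts_measure[OF J ne interval_in_sets_ts_measure[OF J ab]] by simp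
qed

corollary emeasure_delta_measure:
  assumes "time_scale T" "a \<in> T" "b \<in> T" "a \<le> b"
  shows "emeasure (delta_measure T) ({a..<b} \<inter> T) = ennreal (b - a)"
  using emeasure_ts_measure_interval[of T "\<lambda>c d. {c..<d}" a b] assms
  by (simp add: delta_measure_def time_scale_def half_open_def)

corollary emeasure_nabla_measure:
  assumes "time_scale T" "a \<in> T" "b \<in> T" "a \<le> b"
  shows "emeasure (nabla_measure T) ({a<..b} \<inter> T) = ennreal (b - a)"
  using emeasure_ts_measure_interval[of T "\<lambda>c d. {c<..d}" a b] assms
  by (simp add: nabla_measure_def time_scale_def half_open_def)

end

theory Submission
  imports Defs
begin

text \<open>
  For the values \<open>(x, y)\<close> and \<open>(X, Y)\<close> of \<open>(|f|, |g|)\<close> at two points put \<open>u = xY\<close>, \<open>v = yX\<close>.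
  With \<open>e = 2(1 - \<delta>)\<close> and \<open>d = 2\<delta>\<close>, so that \<open>e + d = 2\<close>, Bernoulli's inequality gives
  \<open>(u\<^sup>e - v\<^sup>e)(u\<^sup>d - v\<^sup>d) \<le> 2\<gamma>(u - v)\<^sup>2 \<le> 2\<gamma>(M - m)\<^sup>2y\<^sup>2Y\<^sup>2\<close>.
  Both ends are bilinear in functions of the two points, so applying the positive linear functional
  \<open>h \<mapsto> I(K(t,\<cdot>)|w|h)\<close>, \<open>I\<close> the diamond-\<open>\<alpha>\<close> integral over \<open>[a,t]\<close>, first in one point and then in the other yields twice the claim;
  neither Fubini's theorem nor product measures are needed.
\<close>

text \<open>This is Bernoulli's inequality, read off from Young's inequality with weights
  \<open>1 / e\<close> and \<open>1 - 1 / e\<close> at the points \<open>r powr e\<close> and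
  \<open>1\<close>.\<close>

lemma one_minus_powr_le:
  fixes r e :: real
  assumes "0 < r" "1 \<le> e"
  shows "1 - r powr e \<le> e * (1 - r)"
proof -
  have "r \<le> 1 / e * r powr e + (1 - 1 / e)"
    using Youngs_inequality_0[of "1 / e" "1 - 1 / e" "r powr e" 1] assms by (simp add: powr_powr)
  then have "e * r \<le> e * (1 / e * r powr e + (1 - 1 / e))"
    using assms by (intro mult_left_mono) auto
  then show ?thesis using assms by (simp add: algebra_simps)
qed

text \<open>Since \<open>e + d = 2\<close>, both sides are homogeneous of degree 2, which reduces
  the claim to the ratio \<open>r = v / u\<close> in (0, 1]. The larger exponent satisfies
  \<open>e \<ge> 1\<close>, so Bernoulli bounds its factor; the smaller one satisfies
  \<open>d \<le> 1\<close>, so \<open>r \<le> r powr d\<close>.\<close>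

lemma powr_diff_mult_le_aux:
  fixes u v e d :: real
  assumes "0 < v" "v \<le> u" "0 \<le> d" "d \<le> e" "e + d = 2"
  shows "(u powr e - v powr e) * (u powr d - v powr d) \<le> e * (u - v)\<^sup>2"
proof -
  define r where "r = v / u"
  have u: "0 < u" and r: "0 < r" "r \<le> 1" and v: "v = u * r" using assms by (auto simp: r_def)
  have "(1 - r powr e) * (1 - r powr d) \<le> (e * (1 - r)) * (1 - r)"
  proof (rule mult_mono)
    show "1 - r powr e \<le> e * (1 - r)" using assms r by (intro one_minus_powr_le) auto
    show "1 - r powr d \<le> 1 - r" using powr_mono'[of d 1 r] assms r by simp
    show "0 \<le> 1 - r powr d" using powr_le1[of d r] assms r by simp
    show "0 \<le> e * (1 - r)" using assms r by simp
  qed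
  then have "u\<^sup>2 * ((1 - r powr e) * (1 - r powr d)) \<le> u\<^sup>2 * ((e * (1 - r)) * (1 - r))"
    by (rule mult_left_mono) simp
  moreover have "u\<^sup>2 = u powr e * u powr d"
    using assms u by (simp add: powr_add[symmetric])
  then have "u\<^sup>2 * ((1 - r powr e) * (1 - r powr d)) =
      (u powr e - v powr e) * (u powr d - v powr d)"
    using u r by (simp add: v powr_mult algebra_simps)
  moreover have "u\<^sup>2 * ((e * (1 - r)) * (1 - r)) = e * (u - v)\<^sup>2"
    by (simp add: v power2_eq_square algebra_simps)
  ultimately show ?thesis by simp
qed

text \<open>Exchanging \<open>u\<close> and \<open>v\<close> flips the sign of both factors, and
  exchanging \<open>e\<close> and \<open>d\<close> swaps them, so each of the four orderings is an
  instance of the ordered case.\<close>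

lemma powr_diff_mult_le:
  fixes u v e d :: real
  assumes "0 < u" "0 < v" "0 \<le> d" "0 \<le> e" "e + d = 2"
  shows "(u powr e - v powr e) * (u powr d - v powr d) \<le> max e d * (u - v)\<^sup>2"
  using powr_diff_mult_le_aux[of u v e d] powr_diff_mult_le_aux[of u v d e]
    powr_diff_mult_le_aux[of v u e d] powr_diff_mult_le_aux[of v u d e] assms
  by (cases "u \<le> v"; cases "d \<le> e")
     (simp_all add: max_def power2_commute[of u v] algebra_simps)

lemma two_point_inequality:
  fixes x y X Y e d m M :: real
  assumes pos: "0 < x" "0 < y" "0 < X" "0 < Y" and ed: "0 \<le> d" "0 \<le> e" "e + d = 2"
    and xy: "m \<le> x / y" "x / y \<le> M" and XY: "m \<le> X / Y" "X / Y \<le> M"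
  shows "x\<^sup>2 * Y\<^sup>2 + y\<^sup>2 * X\<^sup>2
      - (x powr e * y powr d) * (X powr d * Y powr e) - (x powr d * y powr e) * (X powr e * Y powr d)
    \<le> max e d * (M - m)\<^sup>2 * (y\<^sup>2 * Y\<^sup>2)"
proof -
  \<comment> \<open>Splitting every square this way makes the left-hand side factor into two
    differences of powers.\<close>
  have sq: "(z::real)\<^sup>2 = z powr e * z powr d" if "0 < z" for z
    using that ed by (simp add: powr_add[symmetric])
  have "x\<^sup>2 * Y\<^sup>2 + y\<^sup>2 * X\<^sup>2
      - (x powr e * y powr d) * (X powr d * Y powr e) - (x powr d * y powr e) * (X powr e * Y powr d)
    = ((x * Y) powr e - (y * X) powr e) * ((x * Y) powr d - (y * X) powr d)"
    using pos by (simp add: sq powr_mult algebra_simps)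
  also have "\<dots> \<le> max e d * (x * Y - y * X)\<^sup>2"
    using pos ed by (intro powr_diff_mult_le) auto
  also have "\<dots> \<le> max e d * ((M - m)\<^sup>2 * (y\<^sup>2 * Y\<^sup>2))"
  proof (rule mult_left_mono)
    \<comment> \<open>Dividing by \<open>y * Y\<close> leaves a difference of two ratios in [m, M],
      hence of absolute value at most \<open>M - m\<close>.\<close>
    have "x * Y - y * X = (x / y - X / Y) * (y * Y)"
      using pos by (simp add: field_simps)
    then have "(x * Y - y * X)\<^sup>2 = (x / y - X / Y)\<^sup>2 * (y\<^sup>2 * Y\<^sup>2)"
      by (simp add: power_mult_distrib)
    also have "\<dots> \<le> (M - m)\<^sup>2 * (y\<^sup>2 * Y\<^sup>2)"
      using xy XY by (intro mult_right_mono) (auto simp: abs_le_square_iff[symmetric])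
    finally show "(x * Y - y * X)\<^sup>2 \<le> (M - m)\<^sup>2 * (y\<^sup>2 * Y\<^sup>2)" .
  qed (use ed in simp)
  finally show ?thesis by (simp add: mult.assoc)
qed

lemma set_lebesgue_integral_lincomb_nonneg:
  fixes h1 h2 h3 h4 :: "'a \<Rightarrow> real"
  assumes "set_integrable N A h1" "set_integrable N A h2"
    "set_integrable N A h3" "set_integrable N A h4"
    and "\<And>s. s \<in> A \<Longrightarrow> 0 \<le> c1 * h1 s + c2 * h2 s + c3 * h3 s + c4 * h4 s"
  shows "0 \<le> c1 * (LINT s:A|N. h1 s) + c2 * (LINT s:A|N. h2 s)
    + c3 * (LINT s:A|N. h3 s) + c4 * (LINT s:A|N. h4 s)"
proof -
  have "0 \<le> (LINT s:A|N. c1 * h1 s + c2 * h2 s + c3 * h3 s + c4 * h4 s)"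
    unfolding set_lebesgue_integral_def
    using assms(5) by (intro Bochner_Integration.integral_nonneg) (auto simp: indicator_def)
  also have "\<dots> = c1 * (LINT s:A|N. h1 s) + c2 * (LINT s:A|N. h2 s)
    + c3 * (LINT s:A|N. h3 s) + c4 * (LINT s:A|N. h4 s)"
    by (subst set_integral_add, (intro set_integral_add set_integrable_mult_right impI assms)+)+ simp
  finally show ?thesis .
qed

text \<open>Nonnegativity on the closed interval covers both half-open domains, that of the delta
  and that of the nabla integral; the weights \<open>\<alpha>\<close> and
  \<open>1 - \<alpha>\<close> are nonnegative.\<close>

lemma diamond_integral_lincomb_nonneg:
  assumes "0 \<le> \<alpha>" "\<alpha> \<le> 1"
    and int: "diamond_integrable T a t h1" "diamond_integrable T a t h2"
      "diamond_integrable T a t h3" "diamond_integrable T a t h4"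
    and nonneg: "\<And>s. s \<in> {a..t} \<inter> T \<Longrightarrow> 0 \<le> c1 * h1 s + c2 * h2 s + c3 * h3 s + c4 * h4 s"
  shows "0 \<le> c1 * diamond_integral \<alpha> T a t h1 + c2 * diamond_integral \<alpha> T a t h2
    + c3 * diamond_integral \<alpha> T a t h3 + c4 * diamond_integral \<alpha> T a t h4"
proof -
  have "0 \<le> c1 * delta_integral T a t h1 + c2 * delta_integral T a t h2
      + c3 * delta_integral T a t h3 + c4 * delta_integral T a t h4" (is "0 \<le> ?D")
    unfolding delta_integral_def
    using int nonneg by (intro set_lebesgue_integral_lincomb_nonneg)
      (auto simp: diamond_integrable_def delta_integrable_def)
  moreover have "0 \<le> c1 * nabla_integral T a t h1 + c2 * nabla_integral T a t h2
      + c3 * nabla_integral T a t h3 + c4 * nabla_integral T a t h4" (is "0 \<le> ?N")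
    unfolding nabla_integral_def
    using int nonneg by (intro set_lebesgue_integral_lincomb_nonneg)
      (auto simp: diamond_integrable_def nabla_integrable_def)
  ultimately have "0 \<le> \<alpha> * ?D + (1 - \<alpha>) * ?N" using assms(1,2) by simp
  then show ?thesis by (simp add: diamond_integral_def algebra_simps)
qed

theorem theorem3p4:
  fixes T :: "real set" and a b t \<alpha> m M \<delta> :: real
    and w f g :: "real \<Rightarrow> real" and K :: "real \<Rightarrow> real \<Rightarrow> real"
  assumes "time_scale T" and "a \<in> T" and "b \<in> T" and "a < b" and "t \<in> {a<..b} \<inter> T"
    and "0 \<le> \<alpha>" and "\<alpha> \<le> 1"
    and "continuous_on ({a..b} \<inter> T) w"
    and "continuous_on ({a..b} \<inter> T) f"
    and "continuous_on ({a..b} \<inter> T) g"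
    and "diamond_integrable T a b w"
    and "diamond_integrable T a b f"
    and "diamond_integrable T a b g"
    and "\<And>x y. x \<in> {a..b} \<inter> T \<Longrightarrow> y \<in> {a..b} \<inter> T \<Longrightarrow> 0 \<le> K x y"
    and "0 < m" and "0 < M"
    and "\<And>s. s \<in> {a..t} \<inter> T \<Longrightarrow> g s \<noteq> 0 \<and> m \<le> \<bar>f s\<bar> / \<bar>g s\<bar> \<and> \<bar>f s\<bar> / \<bar>g s\<bar> \<le> M"
    and "0 \<le> \<delta>" and "\<delta> \<le> 1"
    and "kernel_operator_exists T a K (\<lambda>s. \<bar>w s\<bar> * \<bar>f s\<bar>\<^sup>2) t"
    and "kernel_operator_exists T a K (\<lambda>s. \<bar>w s\<bar> * \<bar>g s\<bar>\<^sup>2) t"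
    and "kernel_operator_exists T a K
           (\<lambda>s. \<bar>w s\<bar> * \<bar>f s\<bar> powr (2 * (1 - \<delta>)) * \<bar>g s\<bar> powr (2 * \<delta>)) t"
    and "kernel_operator_exists T a K
           (\<lambda>s. \<bar>w s\<bar> * \<bar>f s\<bar> powr (2 * \<delta>) * \<bar>g s\<bar> powr (2 * (1 - \<delta>))) t"
  shows "kernel_operator \<alpha> T a K (\<lambda>s. \<bar>w s\<bar> * \<bar>f s\<bar>\<^sup>2) t
           * kernel_operator \<alpha> T a K (\<lambda>s. \<bar>w s\<bar> * \<bar>g s\<bar>\<^sup>2) t
         - kernel_operator \<alpha> T a K
             (\<lambda>s. \<bar>w s\<bar> * \<bar>f s\<bar> powr (2 * (1 - \<delta>)) * \<bar>g s\<bar> powr (2 * \<delta>)) t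
           * kernel_operator \<alpha> T a K
             (\<lambda>s. \<bar>w s\<bar> * \<bar>f s\<bar> powr (2 * \<delta>) * \<bar>g s\<bar> powr (2 * (1 - \<delta>))) t
         \<le> max (1 - \<delta>) \<delta> * (M - m)\<^sup>2
           * (kernel_operator \<alpha> T a K (\<lambda>s. \<bar>w s\<bar> * \<bar>g s\<bar>\<^sup>2) t)\<^sup>2"
proof -
  \<comment> \<open>Here \<open>max e d\<close> is twice \<open>max (1 - \<delta>) \<delta>\<close>,
    so \<open>c\<close> is twice the constant of the claim.\<close>
  define e d c where "e = 2 * (1 - \<delta>)" and "d = 2 * \<delta>" and "c = max e d * (M - m)\<^sup>2"
  have ed: "0 \<le> d" "0 \<le> e" "e + d = 2" using assms(18,19) by (auto simp: e_def d_def)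
  define hA hB hC hD where "hA = (\<lambda>s. K t s * (\<bar>w s\<bar> * \<bar>f s\<bar>\<^sup>2))"
    and "hB = (\<lambda>s. K t s * (\<bar>w s\<bar> * \<bar>g s\<bar>\<^sup>2))"
    and "hC = (\<lambda>s. K t s * (\<bar>w s\<bar> * \<bar>f s\<bar> powr e * \<bar>g s\<bar> powr d))"
    and "hD = (\<lambda>s. K t s * (\<bar>w s\<bar> * \<bar>f s\<bar> powr d * \<bar>g s\<bar> powr e))"
  define A B C D where "A = diamond_integral \<alpha> T a t hA" and "B = diamond_integral \<alpha> T a t hB"
    and "C = diamond_integral \<alpha> T a t hC" and "D = diamond_integral \<alpha> T a t hD"
  have int: "diamond_integrable T a t hA" "diamond_integrable T a t hB"
      "diamond_integrable T a t hC" "diamond_integrable T a t hD"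
    using assms(20-23)
    unfolding kernel_operator_exists_def hA_def hB_def hC_def hD_def e_def d_def by blast+
  have weight: "0 \<le> K t s * \<bar>w s\<bar>" if "s \<in> {a..t} \<inter> T" for s
    using that assms(5) by (intro mult_nonneg_nonneg assms(14)) auto
  have fg: "0 < \<bar>f s\<bar>" "0 < \<bar>g s\<bar>" "m \<le> \<bar>f s\<bar> / \<bar>g s\<bar>" "\<bar>f s\<bar> / \<bar>g s\<bar> \<le> M"
    if "s \<in> {a..t} \<inter> T" for s
    using assms(17)[OF that] \<open>0 < m\<close> by auto
  \<comment> \<open>First integration: \<open>r\<close> is frozen, so the powers of
    \<open>\<bar>f r\<bar>\<close> and \<open>\<bar>g r\<bar>\<close> are the constant
    coefficients.\<close>
  have inner: "0 \<le> (- \<bar>g r\<bar>\<^sup>2) * A + (c * \<bar>g r\<bar>\<^sup>2 - \<bar>f r\<bar>\<^sup>2) * B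
      + (\<bar>f r\<bar> powr d * \<bar>g r\<bar> powr e) * C + (\<bar>f r\<bar> powr e * \<bar>g r\<bar> powr d) * D"
    if r: "r \<in> {a..t} \<inter> T" for r
    unfolding A_def B_def C_def D_def
  proof (rule diamond_integral_lincomb_nonneg[OF assms(6,7) int])
    fix s assume s: "s \<in> {a..t} \<inter> T"
    have "0 \<le> K t s * \<bar>w s\<bar> * (c * (\<bar>g s\<bar>\<^sup>2 * \<bar>g r\<bar>\<^sup>2) -
        (\<bar>f s\<bar>\<^sup>2 * \<bar>g r\<bar>\<^sup>2 + \<bar>g s\<bar>\<^sup>2 * \<bar>f r\<bar>\<^sup>2
          - (\<bar>f s\<bar> powr e * \<bar>g s\<bar> powr d) * (\<bar>f r\<bar> powr d * \<bar>g r\<bar> powr e)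
          - (\<bar>f s\<bar> powr d * \<bar>g s\<bar> powr e) * (\<bar>f r\<bar> powr e * \<bar>g r\<bar> powr d)))"
      using two_point_inequality[OF fg(1,2)[OF s] fg(1,2)[OF r] ed fg(3,4)[OF s] fg(3,4)[OF r]]
      by (intro mult_nonneg_nonneg weight[OF s]) (simp add: c_def)
    then show "0 \<le> (- \<bar>g r\<bar>\<^sup>2) * hA s + (c * \<bar>g r\<bar>\<^sup>2 - \<bar>f r\<bar>\<^sup>2) * hB s
        + (\<bar>f r\<bar> powr d * \<bar>g r\<bar> powr e) * hC s + (\<bar>f r\<bar> powr e * \<bar>g r\<bar> powr d) * hD s"
      by (simp add: hA_def hB_def hC_def hD_def algebra_simps del: power2_abs)
  qed
  have "0 \<le> (- B) * A + (c * B - A) * B + D * C + C * D"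
  proof -
    have "0 \<le> (- B) * diamond_integral \<alpha> T a t hA + (c * B - A) * diamond_integral \<alpha> T a t hB
      + D * diamond_integral \<alpha> T a t hC + C * diamond_integral \<alpha> T a t hD"
    proof (rule diamond_integral_lincomb_nonneg[OF assms(6,7) int])
      fix r assume r: "r \<in> {a..t} \<inter> T"
      \<comment> \<open>Second integration: the roles are exchanged. After multiplication by the
        weight at \<open>r\<close>, the former coefficients become \<open>hA r\<close> to
        \<open>hD r\<close>, and the numbers \<open>A\<close> to \<open>D\<close> are the
        constants.\<close>
      show "0 \<le> (- B) * hA r + (c * B - A) * hB r + D * hC r + C * hD r"
        using mult_nonneg_nonneg[OF weight[OF r] inner[OF r]]
        by (simp add: hA_def hB_def hC_def hD_def algebra_simps del: power2_abs)
    qed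
    then show ?thesis by (simp add: A_def B_def C_def D_def)
  qed
  \<comment> \<open>Both \<open>A * B\<close> and \<open>C * D\<close> occur twice, which accounts
    for the factor 1/2.\<close>
  then have "A * B - C * D \<le> c / 2 * B\<^sup>2"
    by (simp add: power2_eq_square algebra_simps)
  also have "c / 2 = max (1 - \<delta>) \<delta> * (M - m)\<^sup>2"
    by (auto simp: c_def e_def d_def max_def)
  finally show ?thesis
    unfolding kernel_operator_def A_def B_def C_def D_def hA_def hB_def hC_def hD_def e_def d_def .
qed

end
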